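(* Let $G$ be a group and let $L_1$ and $L_2$ be $G$-graded Lie algebras over an arbitrary field $\mathbb{F}$. Assume that there exists an isomorphism of (ungraded) algebras $\psi:L_1\to L_2$ such that both the induced map $L_1/\mathfrak{z}(L_1)\to L_2/\mathfrak{z}(L_2)$ and the restriction $\mathfrak{z}(L_1)\to\mathfrak{z}(L_2)$ are $G$-graded isomorphisms. Then $L_1$ and $L_2$ are isomorphic as $G$-graded algebras.
   Context: A $G$-grading on a Lie algebra $L$ is a vector space decomposition $L=\bigoplus_{g\in G}L_g$ with $[L_g,L_h]\subset L_{gh}$. $\mathfrak{z}(L)$ denotes the center of $L$; it is a graded ideal, and $\mathfrak{z}(L)$ and $L/\mathfrak{z}(L)$ carry the induced $G$-gradings. A $G$-graded isomorphism is an algebra isomorphism mapping the component of degree $g$ into the component of degree $g$ for every $g\in G$. *)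

theory Defs
  imports "HOL-Algebra.Module" "HOL-Algebra.QuotRing"
begin

text \<open>
  A Lie algebra over \<open>F\<close> is carried by the record type of \<open>F\<close>-modules. The Lie bracket is the
  \<^const>\<open>monoid.mult\<close> field, so \<open>x \<otimes>\<^bsub>L\<^esub> y\<close> stands for \<open>[x, y]\<close>. The \<^const>\<open>monoid.one\<close> field of the record
  is unconstrained and is ignored everywhere.
\<close>

locale lie_algebra = module F L + field F
  for F :: "('k, 'm) ring_scheme" (structure) and L :: "('k, 'a, 'n) module_scheme" (structure) +
  assumes bracket_closed:
      "\<lbrakk>x \<in> carrier L; y \<in> carrier L\<rbrakk> \<Longrightarrow> x \<otimes>\<^bsub>L\<^esub> y \<in> carrier L"
    and bracket_add_left:
      "\<lbrakk>x \<in> carrier L; y \<in> carrier L; z \<in> carrier L\<rbrakk>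
        \<Longrightarrow> (x \<oplus>\<^bsub>L\<^esub> y) \<otimes>\<^bsub>L\<^esub> z = (x \<otimes>\<^bsub>L\<^esub> z) \<oplus>\<^bsub>L\<^esub> (y \<otimes>\<^bsub>L\<^esub> z)"
    and bracket_add_right:
      "\<lbrakk>x \<in> carrier L; y \<in> carrier L; z \<in> carrier L\<rbrakk>
        \<Longrightarrow> x \<otimes>\<^bsub>L\<^esub> (y \<oplus>\<^bsub>L\<^esub> z) = (x \<otimes>\<^bsub>L\<^esub> y) \<oplus>\<^bsub>L\<^esub> (x \<otimes>\<^bsub>L\<^esub> z)"
    and bracket_smult_left:
      "\<lbrakk>a \<in> carrier F; x \<in> carrier L; y \<in> carrier L\<rbrakk>
        \<Longrightarrow> (a \<odot>\<^bsub>L\<^esub> x) \<otimes>\<^bsub>L\<^esub> y = a \<odot>\<^bsub>L\<^esub> (x \<otimes>\<^bsub>L\<^esub> y)"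
    and bracket_smult_right:
      "\<lbrakk>a \<in> carrier F; x \<in> carrier L; y \<in> carrier L\<rbrakk>
        \<Longrightarrow> x \<otimes>\<^bsub>L\<^esub> (a \<odot>\<^bsub>L\<^esub> y) = a \<odot>\<^bsub>L\<^esub> (x \<otimes>\<^bsub>L\<^esub> y)"
    and bracket_self:
      "x \<in> carrier L \<Longrightarrow> x \<otimes>\<^bsub>L\<^esub> x = \<zero>\<^bsub>L\<^esub>"
    and jacobi:
      "\<lbrakk>x \<in> carrier L; y \<in> carrier L; z \<in> carrier L\<rbrakk>
        \<Longrightarrow> (x \<otimes>\<^bsub>L\<^esub> (y \<otimes>\<^bsub>L\<^esub> z)) \<oplus>\<^bsub>L\<^esub> (y \<otimes>\<^bsub>L\<^esub> (z \<otimes>\<^bsub>L\<^esub> x)) \<oplus>\<^bsub>L\<^esub> (z \<otimes>\<^bsub>L\<^esub> (x \<otimes>\<^bsub>L\<^esub> y)) = \<zero>\<^bsub>L\<^esub>"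

text \<open>
  Internal direct sum over a possibly infinite index set: every vector is a finite sum of
  components in a unique way. A family of components is an extensional function on \<open>I\<close>, so that
  \<open>\<exists>!\<close> is not spoiled by values outside \<open>I\<close>.
\<close>

definition direct_sum_decomp ::
  "('k, 'm) ring_scheme \<Rightarrow> ('k, 'a, 'n) module_scheme \<Rightarrow> 'g set \<Rightarrow> ('g \<Rightarrow> 'a set) \<Rightarrow> bool"
  where "direct_sum_decomp F L I N \<longleftrightarrow>
    (\<forall>g\<in>I. submodule (N g) F L) \<and>
    (\<forall>x\<in>carrier L. \<exists>!f. f \<in> (\<Pi>\<^sub>E g\<in>I. N g) \<and> finite {g \<in> I. f g \<noteq> \<zero>\<^bsub>L\<^esub>} \<and>
       x = (\<Oplus>\<^bsub>L\<^esub>g\<in>{g \<in> I. f g \<noteq> \<zero>\<^bsub>L\<^esub>}. f g))"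

locale graded_lie_algebra = lie_algebra F L + grp: group G
  for F :: "('k, 'm) ring_scheme" (structure) and L :: "('k, 'a, 'n) module_scheme" (structure)
    and G :: "('g, 'p) monoid_scheme" (structure) and \<Gamma> :: "'g \<Rightarrow> 'a set" +
  assumes decomposition: "direct_sum_decomp F L (carrier G) \<Gamma>"
    and bracket_degree:
      "\<lbrakk>g \<in> carrier G; h \<in> carrier G; x \<in> \<Gamma> g; y \<in> \<Gamma> h\<rbrakk> \<Longrightarrow> x \<otimes>\<^bsub>L\<^esub> y \<in> \<Gamma> (g \<otimes>\<^bsub>G\<^esub> h)"

definition lie_iso ::
  "('k, 'm) ring_scheme \<Rightarrow> ('k, 'a, 'n) module_scheme \<Rightarrow> ('k, 'b, 'q) module_scheme \<Rightarrow> ('a \<Rightarrow> 'b) set"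
  where "lie_iso F L M = {\<phi>. bij_betw \<phi> (carrier L) (carrier M) \<and>
    (\<forall>x\<in>carrier L. \<forall>y\<in>carrier L. \<phi> (x \<oplus>\<^bsub>L\<^esub> y) = \<phi> x \<oplus>\<^bsub>M\<^esub> \<phi> y) \<and>
    (\<forall>a\<in>carrier F. \<forall>x\<in>carrier L. \<phi> (a \<odot>\<^bsub>L\<^esub> x) = a \<odot>\<^bsub>M\<^esub> \<phi> x) \<and>
    (\<forall>x\<in>carrier L. \<forall>y\<in>carrier L. \<phi> (x \<otimes>\<^bsub>L\<^esub> y) = \<phi> x \<otimes>\<^bsub>M\<^esub> \<phi> y)}"

definition graded_lie_iso ::
  "('k, 'm) ring_scheme \<Rightarrow> ('g, 'p) monoid_scheme \<Rightarrow>
   ('k, 'a, 'n) module_scheme \<Rightarrow> ('g \<Rightarrow> 'a set) \<Rightarrow>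
   ('k, 'b, 'q) module_scheme \<Rightarrow> ('g \<Rightarrow> 'b set) \<Rightarrow> ('a \<Rightarrow> 'b) set"
  where "graded_lie_iso F G L \<Gamma> M \<Delta> = {\<phi> \<in> lie_iso F L M. \<forall>g\<in>carrier G. \<phi> ` \<Gamma> g \<subseteq> \<Delta> g}"

definition lie_center :: "('k, 'a, 'n) module_scheme \<Rightarrow> 'a set"
  where "lie_center L = {z \<in> carrier L. \<forall>x\<in>carrier L. z \<otimes>\<^bsub>L\<^esub> x = \<zero>\<^bsub>L\<^esub>}"

definition center_alg :: "('k, 'a, 'n) module_scheme \<Rightarrow> ('k, 'a, 'n) module_scheme"
  where "center_alg L = L\<lparr>carrier := lie_center L\<rparr>"

definition center_grading ::
  "('k, 'a, 'n) module_scheme \<Rightarrow> ('g \<Rightarrow> 'a set) \<Rightarrow> 'g \<Rightarrow> 'a set"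
  where "center_grading L \<Gamma> g = lie_center L \<inter> \<Gamma> g"

text \<open>
  The quotient by an ideal \<open>I\<close> is the coset construction of \<^const>\<open>FactRing\<close>, extended by scalar
  multiplication; the ignored \<^const>\<open>monoid.one\<close> field is left undefined.
\<close>

definition quot_alg :: "('k, 'a, 'n) module_scheme \<Rightarrow> 'a set \<Rightarrow> ('k, 'a set) module"
  where "quot_alg L I =
    \<lparr>carrier = a_rcosets\<^bsub>L\<^esub> I, monoid.mult = rcoset_mult L I, monoid.one = undefined,
     zero = I, add = set_add L,
     smult = (\<lambda>a A. \<Union>x\<in>A. I +>\<^bsub>L\<^esub> (a \<odot>\<^bsub>L\<^esub> x))\<rparr>"

definition quot_grading ::
  "('k, 'a, 'n) module_scheme \<Rightarrow> 'a set \<Rightarrow> ('g \<Rightarrow> 'a set) \<Rightarrow> 'g \<Rightarrow> 'a set set"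
  where "quot_grading L I \<Gamma> g = (\<lambda>x. I +>\<^bsub>L\<^esub> x) ` \<Gamma> g"

text \<open>
  The map \<open>I + x \<mapsto> J + \<psi> x\<close> on cosets. The union ranges over equal cosets of \<open>J\<close> whenever
  \<open>\<psi>\<close> is additive and maps \<open>I\<close> into \<open>J\<close>.
\<close>

definition induced_map :: "('k, 'b, 'q) module_scheme \<Rightarrow> 'b set \<Rightarrow> ('a \<Rightarrow> 'b) \<Rightarrow> 'a set \<Rightarrow> 'b set"
  where "induced_map M J \<psi> A = (\<Union>x\<in>A. J +>\<^bsub>M\<^esub> \<psi> x)"

end

theory Submission
  imports Defs
begin

text \<open>
  The given \<open>\<psi>\<close> need not be homogeneous, but it fails to be so only by central vectors: since the
  map on \<open>L1 / \<zz>(L1)\<close> is graded, \<open>\<psi> x \<in> \<Gamma>2 g + \<zz>(L2)\<close> for \<open>x \<in> \<Gamma>1 g\<close>. The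
  graded isomorphism is the degree-preserving part of \<open>\<psi>\<close>: the linear map \<open>\<phi>\<close> that sends
  \<open>x \<in> \<Gamma>1 g\<close> to the component of \<open>\<psi> x\<close> of degree \<open>g\<close>.

  The center of a graded Lie algebra contains the homogeneous components of its elements
  (\<open>component_in_center\<close>). Two facts about \<open>\<phi>\<close> follow. First, \<open>\<phi> x\<close> and \<open>\<psi> x\<close> always differ by a
  central vector. Secondly, \<open>\<phi> = \<psi>\<close> on \<open>\<zz>(L1)\<close>, because \<open>\<psi>\<close> preserves the degree of central
  homogeneous vectors. The two facts make \<open>\<phi>\<close> bijective: modulo the centers and on the centers it
  is \<open>\<psi>\<close>.

  For the bracket let \<open>x\<close>, \<open>y\<close> be homogeneous of degrees \<open>g\<close>, \<open>h\<close>. Central summands do not affect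
  brackets, so \<open>[\<phi> x, \<phi> y] = [\<psi> x, \<psi> y] = \<psi> [x, y]\<close>. The left-hand side has degree \<open>g h\<close>;
  hence so does \<open>\<psi> [x, y]\<close>, which is therefore its own component of degree \<open>g h\<close>, namely
  \<open>\<phi> [x, y]\<close>. Bilinearity extends this from homogeneous to arbitrary vectors.
\<close>

section \<open>Homogeneous components in a graded module\<close>

locale decomposed_module = module F L
  for F :: "('k, 'm) ring_scheme" (structure) and L :: "('k, 'a, 'n) module_scheme" (structure) +
  fixes I :: "'g set" and N :: "'g \<Rightarrow> 'a set"
  assumes decomp: "direct_sum_decomp F L I N"
begin

definition component :: "'g \<Rightarrow> 'a \<Rightarrow> 'a" where
  "component g x = (THE f. f \<in> (\<Pi>\<^sub>E g\<in>I. N g) \<and> finite {g \<in> I. f g \<noteq> \<zero>\<^bsub>L\<^esub>} \<and>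
     x = (\<Oplus>\<^bsub>L\<^esub>g\<in>{g \<in> I. f g \<noteq> \<zero>\<^bsub>L\<^esub>}. f g)) g"

definition support :: "'a \<Rightarrow> 'g set" where
  "support x = {g \<in> I. component g x \<noteq> \<zero>\<^bsub>L\<^esub>}"

lemma part_submodule: "g \<in> I \<Longrightarrow> submodule (N g) F L"
  using decomp by (simp add: direct_sum_decomp_def)

lemma part_carrier: "g \<in> I \<Longrightarrow> x \<in> N g \<Longrightarrow> x \<in> carrier L"
  using submoduleE(1)[OF part_submodule] by blast

lemma part_add: "g \<in> I \<Longrightarrow> x \<in> N g \<Longrightarrow> y \<in> N g \<Longrightarrow> x \<oplus>\<^bsub>L\<^esub> y \<in> N g"
  using submoduleE(5)[OF part_submodule] by blast

lemma part_smult: "g \<in> I \<Longrightarrow> a \<in> carrier F \<Longrightarrow> x \<in> N g \<Longrightarrow> a \<odot>\<^bsub>L\<^esub> x \<in> N g"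
  using submoduleE(4)[OF part_submodule] by blast

lemma part_zero: "g \<in> I \<Longrightarrow> \<zero>\<^bsub>L\<^esub> \<in> N g"
  using subgroup.one_closed[OF submodule.axioms(1)[OF part_submodule]] by simp

lemma component_part: "x \<in> carrier L \<Longrightarrow> g \<in> I \<Longrightarrow> component g x \<in> N g"
  and finite_support: "x \<in> carrier L \<Longrightarrow> finite (support x)"
  and component_sum: "x \<in> carrier L \<Longrightarrow> x = (\<Oplus>\<^bsub>L\<^esub>g\<in>support x. component g x)"
proof -
  let ?P = "\<lambda>f x. f \<in> (\<Pi>\<^sub>E g\<in>I. N g) \<and> finite {g \<in> I. f g \<noteq> \<zero>\<^bsub>L\<^esub>} \<and>
     x = (\<Oplus>\<^bsub>L\<^esub>g\<in>{g \<in> I. f g \<noteq> \<zero>\<^bsub>L\<^esub>}. f g)"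
  have ex: "?P (\<lambda>g. component g x) x" if "x \<in> carrier L" for x
  proof -
    have "\<exists>!f. ?P f x"
      using decomp that by (simp add: direct_sum_decomp_def)
    from theI'[OF this] show ?thesis
      by (simp add: component_def)
  qed
  show "x \<in> carrier L \<Longrightarrow> g \<in> I \<Longrightarrow> component g x \<in> N g"
    using ex[of x] by (blast dest: PiE_mem)
  show "x \<in> carrier L \<Longrightarrow> finite (support x)"
    using ex[of x] by (simp add: support_def)
  show "x \<in> carrier L \<Longrightarrow> x = (\<Oplus>\<^bsub>L\<^esub>g\<in>support x. component g x)"
    using ex[of x] by (simp add: support_def)
qed

lemma component_carrier: "x \<in> carrier L \<Longrightarrow> g \<in> I \<Longrightarrow> component g x \<in> carrier L"
  using component_part part_carrier by blast

lemma component_unique: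
  assumes "finite A" "A \<subseteq> I" "\<And>g. g \<in> I \<Longrightarrow> f g \<in> N g"
    and zero: "\<And>g. g \<in> I - A \<Longrightarrow> f g = \<zero>\<^bsub>L\<^esub>"
    and h: "h \<in> I"
  shows "component h (\<Oplus>\<^bsub>L\<^esub>g\<in>A. f g) = f h"
proof -
  let ?x = "\<Oplus>\<^bsub>L\<^esub>g\<in>A. f g"
  let ?P = "\<lambda>f. f \<in> (\<Pi>\<^sub>E g\<in>I. N g) \<and> finite {g \<in> I. f g \<noteq> \<zero>\<^bsub>L\<^esub>} \<and>
     ?x = (\<Oplus>\<^bsub>L\<^esub>g\<in>{g \<in> I. f g \<noteq> \<zero>\<^bsub>L\<^esub>}. f g)"
  let ?f = "restrict f I"
  have S: "{g \<in> I. ?f g \<noteq> \<zero>\<^bsub>L\<^esub>} = {g \<in> A. f g \<noteq> \<zero>\<^bsub>L\<^esub>}"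
    using zero assms(2) by auto
  have fc: "f g \<in> carrier L" if "g \<in> A" for g
    using that assms part_carrier by blast
  have "?x = (\<Oplus>\<^bsub>L\<^esub>g\<in>{g \<in> A. f g \<noteq> \<zero>\<^bsub>L\<^esub>}. f g)"
    by (rule M.add.finprod_mono_neutral_cong_right) (use assms(1) fc in auto)
  also have "\<dots> = (\<Oplus>\<^bsub>L\<^esub>g\<in>{g \<in> A. f g \<noteq> \<zero>\<^bsub>L\<^esub>}. ?f g)"
    by (rule M.finsum_cong') (use assms(2) fc in auto)
  finally have P: "?P ?f"
    unfolding S using assms(1,3) by auto
  have "?x \<in> carrier L"
    using fc by (intro M.finsum_closed) auto
  then have ex1: "\<exists>!f. ?P f"
    using decomp by (simp add: direct_sum_decomp_def)
  have "(THE f. ?P f) = ?f"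
    by (rule the1_equality[where P = ?P and a = ?f]) (rule ex1, rule P)
  then show ?thesis
    using h by (simp add: component_def)
qed

lemma component_homogeneous:
  assumes "g \<in> I" "h \<in> I" "x \<in> N g"
  shows "component h x = (if h = g then x else \<zero>\<^bsub>L\<^esub>)"
proof -
  have x: "x \<in> carrier L"
    using assms part_carrier by blast
  have "component h (\<Oplus>\<^bsub>L\<^esub>k\<in>{g}. if k = g then x else \<zero>\<^bsub>L\<^esub>) = (if h = g then x else \<zero>\<^bsub>L\<^esub>)"
    by (rule component_unique) (use assms part_zero in auto)
  then show ?thesis
    using x by simp
qed

lemma component_zero: "h \<in> I \<Longrightarrow> component h \<zero>\<^bsub>L\<^esub> = \<zero>\<^bsub>L\<^esub>"
  using component_homogeneous[of h h] part_zero by simp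

lemma component_add:
  assumes x: "x \<in> carrier L" and y: "y \<in> carrier L" and h: "h \<in> I"
  shows "component h (x \<oplus>\<^bsub>L\<^esub> y) = component h x \<oplus>\<^bsub>L\<^esub> component h y"
proof -
  let ?A = "support x \<union> support y"
  have A: "?A \<subseteq> I" "finite ?A"
    using finite_support x y by (auto simp: support_def)
  have ext: "z = (\<Oplus>\<^bsub>L\<^esub>g\<in>?A. component g z)"
    if z: "z \<in> carrier L" and "support z \<subseteq> ?A" for z
  proof -
    have "(\<Oplus>\<^bsub>L\<^esub>g\<in>support z. component g z) = (\<Oplus>\<^bsub>L\<^esub>g\<in>?A. component g z)"
      by (rule M.add.finprod_mono_neutral_cong_left)
        (use A that component_carrier in \<open>auto simp: support_def\<close>)
    then show ?thesis
      using component_sum[OF z] by simp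
  qed
  have "x \<oplus>\<^bsub>L\<^esub> y = (\<Oplus>\<^bsub>L\<^esub>g\<in>?A. component g x) \<oplus>\<^bsub>L\<^esub> (\<Oplus>\<^bsub>L\<^esub>g\<in>?A. component g y)"
    using ext[OF x] ext[OF y] by simp
  also have "\<dots> = (\<Oplus>\<^bsub>L\<^esub>g\<in>?A. component g x \<oplus>\<^bsub>L\<^esub> component g y)"
    by (rule M.finsum_addf[symmetric]) (use A x y component_carrier in auto)
  finally have eq: "x \<oplus>\<^bsub>L\<^esub> y = (\<Oplus>\<^bsub>L\<^esub>g\<in>?A. component g x \<oplus>\<^bsub>L\<^esub> component g y)" .
  show ?thesis
    unfolding eq
    by (rule component_unique)
      (use A h x y component_part part_add in \<open>auto simp: support_def\<close>)
qed

lemma component_smult: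
  assumes a: "a \<in> carrier F" and x: "x \<in> carrier L" and h: "h \<in> I"
  shows "component h (a \<odot>\<^bsub>L\<^esub> x) = a \<odot>\<^bsub>L\<^esub> component h x"
proof -
  have "a \<odot>\<^bsub>L\<^esub> x = a \<odot>\<^bsub>L\<^esub> (\<Oplus>\<^bsub>L\<^esub>g\<in>support x. component g x)"
    using component_sum[OF x] by simp
  also have "\<dots> = (\<Oplus>\<^bsub>L\<^esub>g\<in>support x. a \<odot>\<^bsub>L\<^esub> component g x)"
    by (rule finsum_smult_ldistr) (use a x finite_support component_carrier in \<open>auto simp: support_def\<close>)
  finally have eq: "a \<odot>\<^bsub>L\<^esub> x = (\<Oplus>\<^bsub>L\<^esub>g\<in>support x. a \<odot>\<^bsub>L\<^esub> component g x)" .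
  show ?thesis
    unfolding eq
    by (rule component_unique)
      (use a h x component_part part_smult finite_support in \<open>auto simp: support_def\<close>)
qed

lemma component_eqI:
  assumes "x \<in> carrier L" "y \<in> carrier L" "\<And>g. g \<in> I \<Longrightarrow> component g x = component g y"
  shows "x = y"
proof -
  have S: "support x = support y"
    using assms(3) by (auto simp: support_def)
  have "x = (\<Oplus>\<^bsub>L\<^esub>g\<in>support y. component g x)"
    using component_sum[OF assms(1)] by (simp add: S)
  also have "\<dots> = (\<Oplus>\<^bsub>L\<^esub>g\<in>support y. component g y)"
    by (rule M.finsum_cong') (use assms component_carrier in \<open>auto simp: support_def\<close>)
  finally show ?thesis
    using component_sum[OF assms(2)] by simp
qed

text \<open>
  Only the components of the vector at hand have to satisfy \<open>P\<close>, so that the rule also serves for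
  the elements of a graded submodule.
\<close>

lemma component_induct [consumes 1, case_names zero add component]:
  assumes x: "x \<in> carrier L"
    and zero: "P \<zero>\<^bsub>L\<^esub>"
    and add: "\<And>u v. u \<in> carrier L \<Longrightarrow> v \<in> carrier L \<Longrightarrow> P u \<Longrightarrow> P v \<Longrightarrow> P (u \<oplus>\<^bsub>L\<^esub> v)"
    and comp: "\<And>g. g \<in> I \<Longrightarrow> P (component g x)"
  shows "P x"
proof -
  have "P (\<Oplus>\<^bsub>L\<^esub>g\<in>A. component g x)" if "finite A" "A \<subseteq> I" for A
    using that
  proof (induction A)
    case empty
    show ?case using zero by simp
  next
    case (insert g A)
    have c: "(\<lambda>g. component g x) \<in> A \<rightarrow> carrier L"
      using insert.prems x component_carrier by auto
    show ?case
      using insert x comp add component_carrier c M.finsum_closed[OF c]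
      by simp
  qed
  from this[OF finite_support[OF x]] show ?thesis
    using component_sum[OF x] by (simp add: support_def)
qed

lemma homogeneous_induct [consumes 1, case_names zero add homogeneous]:
  assumes "x \<in> carrier L" "P \<zero>\<^bsub>L\<^esub>"
    and "\<And>u v. u \<in> carrier L \<Longrightarrow> v \<in> carrier L \<Longrightarrow> P u \<Longrightarrow> P v \<Longrightarrow> P (u \<oplus>\<^bsub>L\<^esub> v)"
    and "\<And>g u. g \<in> I \<Longrightarrow> u \<in> N g \<Longrightarrow> P u"
  shows "P x"
  using assms(1)
  by (induction rule: component_induct) (use assms component_part in auto)

end

section \<open>The degree-preserving part of a linear map\<close>

locale decomposed_linear_map =
  D1: decomposed_module F L I N + D2: decomposed_module F M I K
  for F :: "('k, 'm) ring_scheme" and L :: "('k, 'a, 'n) module_scheme"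
    and M :: "('k, 'b, 'q) module_scheme" and I :: "'g set"
    and N :: "'g \<Rightarrow> 'a set" and K :: "'g \<Rightarrow> 'b set" +
  fixes \<psi> :: "'a \<Rightarrow> 'b"
  assumes map_closed: "x \<in> carrier L \<Longrightarrow> \<psi> x \<in> carrier M"
    and map_add: "\<lbrakk>x \<in> carrier L; y \<in> carrier L\<rbrakk> \<Longrightarrow> \<psi> (x \<oplus>\<^bsub>L\<^esub> y) = \<psi> x \<oplus>\<^bsub>M\<^esub> \<psi> y"
    and map_smult: "\<lbrakk>a \<in> carrier F; x \<in> carrier L\<rbrakk> \<Longrightarrow> \<psi> (a \<odot>\<^bsub>L\<^esub> x) = a \<odot>\<^bsub>M\<^esub> \<psi> x"
begin

definition degree_part :: "'a \<Rightarrow> 'b" where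
  "degree_part x = (\<Oplus>\<^bsub>M\<^esub>g\<in>D1.support x. D2.component g (\<psi> (D1.component g x)))"

lemma map_zero: "\<psi> \<zero>\<^bsub>L\<^esub> = \<zero>\<^bsub>M\<^esub>"
  using map_add[of "\<zero>\<^bsub>L\<^esub>" "\<zero>\<^bsub>L\<^esub>"] map_closed[of "\<zero>\<^bsub>L\<^esub>"] by simp

lemma degree_part_closed: "x \<in> carrier L \<Longrightarrow> degree_part x \<in> carrier M"
  unfolding degree_part_def
  by (rule D2.M.finsum_closed)
    (auto simp: D1.support_def intro: D2.component_carrier map_closed D1.component_carrier)

text \<open>
  Vectors with equal components are equal, so this equation determines \<open>degree_part x\<close>. Unlike the
  defining sum, whose index set depends on \<open>x\<close>, it makes linearity evident.
\<close>

lemma component_degree_part: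
  assumes x: "x \<in> carrier L" and g: "g \<in> I"
  shows "D2.component g (degree_part x) = D2.component g (\<psi> (D1.component g x))"
  unfolding degree_part_def
  by (rule D2.component_unique)
    (use assms in \<open>auto simp: D1.support_def D1.finite_support[unfolded D1.support_def] map_zero
      D2.component_zero intro: D2.component_part map_closed D1.component_carrier\<close>)

lemma degree_part_homogeneous:
  assumes "g \<in> I" "x \<in> N g"
  shows "degree_part x = D2.component g (\<psi> x)"
proof (rule D2.component_eqI)
  have x: "x \<in> carrier L"
    using assms D1.part_carrier by blast
  have c: "D2.component g (\<psi> x) \<in> K g"
    using assms x D2.component_part map_closed by blast
  show "degree_part x \<in> carrier M" "D2.component g (\<psi> x) \<in> carrier M"
    using degree_part_closed x D2.part_carrier[OF assms(1) c] by auto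
  fix h assume h: "h \<in> I"
  show "D2.component h (degree_part x) = D2.component h (D2.component g (\<psi> x))"
    using assms h x c
    by (simp add: component_degree_part D1.component_homogeneous[OF assms(1) h assms(2)]
        D2.component_homogeneous[OF assms(1) h c] map_zero D2.component_zero)
qed

lemma degree_part_add:
  assumes x: "x \<in> carrier L" and y: "y \<in> carrier L"
  shows "degree_part (x \<oplus>\<^bsub>L\<^esub> y) = degree_part x \<oplus>\<^bsub>M\<^esub> degree_part y"
  by (rule D2.component_eqI)
    (use assms in \<open>auto simp: component_degree_part degree_part_closed D2.component_add
      D1.component_add D1.component_carrier map_add map_closed\<close>)

lemma degree_part_smult:
  assumes "a \<in> carrier F" "x \<in> carrier L"
  shows "degree_part (a \<odot>\<^bsub>L\<^esub> x) = a \<odot>\<^bsub>M\<^esub> degree_part x"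
  by (rule D2.component_eqI)
    (use assms in \<open>auto simp: component_degree_part degree_part_closed D2.component_smult
      D1.component_smult D1.component_carrier map_smult map_closed\<close>)

lemma degree_part_zero: "degree_part \<zero>\<^bsub>L\<^esub> = \<zero>\<^bsub>M\<^esub>"
  using degree_part_add[of "\<zero>\<^bsub>L\<^esub>" "\<zero>\<^bsub>L\<^esub>"] degree_part_closed[of "\<zero>\<^bsub>L\<^esub>"] by simp

text \<open>On a graded submodule where \<open>\<psi>\<close> already preserves degrees nothing changes.\<close>

lemma degree_part_eq:
  assumes x: "x \<in> carrier L" and deg: "\<And>g. g \<in> I \<Longrightarrow> \<psi> (D1.component g x) \<in> K g"
  shows "degree_part x = \<psi> x"
  using x
proof (induction rule: D1.component_induct)
  case (component g)
  then show ?case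
    using x deg D1.component_part
    by (simp add: degree_part_homogeneous D2.component_homogeneous)
qed (simp_all add: degree_part_zero map_zero degree_part_add map_add)

end

section \<open>The center of a graded Lie algebra\<close>

context lie_algebra
begin

lemma bracket_zero_left: "y \<in> carrier L \<Longrightarrow> \<zero>\<^bsub>L\<^esub> \<otimes>\<^bsub>L\<^esub> y = \<zero>\<^bsub>L\<^esub>"
  using bracket_smult_left[of "\<zero>\<^bsub>F\<^esub>" "\<zero>\<^bsub>L\<^esub>" y] bracket_closed[of "\<zero>\<^bsub>L\<^esub>" y] by simp

lemma bracket_zero_right: "x \<in> carrier L \<Longrightarrow> x \<otimes>\<^bsub>L\<^esub> \<zero>\<^bsub>L\<^esub> = \<zero>\<^bsub>L\<^esub>"
  using bracket_smult_right[of "\<zero>\<^bsub>F\<^esub>" x "\<zero>\<^bsub>L\<^esub>"] bracket_closed[of x "\<zero>\<^bsub>L\<^esub>"] by simp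

text \<open>
  The center annihilates from the left by definition; from the right it does so by
  anticommutativity, which is \<open>[x + z, x + z] = 0\<close> expanded.
\<close>

lemma bracket_center_right:
  assumes x: "x \<in> carrier L" and z: "z \<in> lie_center L"
  shows "x \<otimes>\<^bsub>L\<^esub> z = \<zero>\<^bsub>L\<^esub>"
proof -
  have zc: "z \<in> carrier L" and zx: "z \<otimes>\<^bsub>L\<^esub> x = \<zero>\<^bsub>L\<^esub>"
    using assms by (auto simp: lie_center_def)
  have "\<zero>\<^bsub>L\<^esub> = (x \<oplus>\<^bsub>L\<^esub> z) \<otimes>\<^bsub>L\<^esub> (x \<oplus>\<^bsub>L\<^esub> z)"
    using x zc by (simp add: bracket_self)
  also have "\<dots> = x \<otimes>\<^bsub>L\<^esub> z"
    using x zc zx bracket_self[OF x] bracket_self[OF zc] bracket_closed[OF x zc]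
    by (simp add: bracket_add_left bracket_add_right)
  finally show ?thesis by simp
qed

lemma center_carrier: "z \<in> lie_center L \<Longrightarrow> z \<in> carrier L"
  by (simp add: lie_center_def)

lemma center_zero: "\<zero>\<^bsub>L\<^esub> \<in> lie_center L"
  by (simp add: lie_center_def bracket_zero_left)

lemma center_add: "z \<in> lie_center L \<Longrightarrow> w \<in> lie_center L \<Longrightarrow> z \<oplus>\<^bsub>L\<^esub> w \<in> lie_center L"
  by (simp add: lie_center_def bracket_add_left)

lemma center_smult: "a \<in> carrier F \<Longrightarrow> z \<in> lie_center L \<Longrightarrow> a \<odot>\<^bsub>L\<^esub> z \<in> lie_center L"
  by (simp add: lie_center_def bracket_smult_left)

lemma center_minus: "z \<in> lie_center L \<Longrightarrow> \<ominus>\<^bsub>L\<^esub> z \<in> lie_center L"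
  using center_smult[of "\<ominus>\<^bsub>F\<^esub> \<one>\<^bsub>F\<^esub>" z] center_carrier by (simp add: smult_l_minus)

lemma bracket_mod_center:
  assumes "x \<in> carrier L" "y \<in> carrier L" "z \<in> lie_center L" "w \<in> lie_center L"
  shows "(x \<oplus>\<^bsub>L\<^esub> z) \<otimes>\<^bsub>L\<^esub> (y \<oplus>\<^bsub>L\<^esub> w) = x \<otimes>\<^bsub>L\<^esub> y"
proof -
  have zw: "z \<in> carrier L" "w \<in> carrier L"
    using assms center_carrier by auto
  have "z \<otimes>\<^bsub>L\<^esub> (y \<oplus>\<^bsub>L\<^esub> w) = \<zero>\<^bsub>L\<^esub>"
    using assms zw by (simp add: lie_center_def)
  then show ?thesis
    using bracket_add_left[of x z "y \<oplus>\<^bsub>L\<^esub> w"] bracket_add_right[of x y w]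
      bracket_center_right[of x w] bracket_closed[of x y] assms zw
    by simp
qed

end

sublocale graded_lie_algebra \<subseteq> decomposed_module F L "carrier G" \<Gamma>
  by unfold_locales (rule decomposition)

context graded_lie_algebra
begin

text \<open>
  Right cancellation in \<open>G\<close> is what makes this hold: no component of \<open>z\<close> of degree other than \<open>g\<close>
  contributes to the degree \<open>g h\<close> of \<open>[z, x]\<close>.
\<close>

lemma component_bracket:
  assumes g: "g \<in> carrier G" and h: "h \<in> carrier G" and z: "z \<in> carrier L" and x: "x \<in> \<Gamma> h"
  shows "component (g \<otimes>\<^bsub>G\<^esub> h) (z \<otimes>\<^bsub>L\<^esub> x) = component g z \<otimes>\<^bsub>L\<^esub> x"
  using z
proof (induction rule: homogeneous_induct)
  case zero
  then show ?case
    using part_carrier[OF h x] g h by (simp add: bracket_zero_left component_zero)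
next
  case (add u v)
  then show ?case
    using part_carrier[OF h x] g h
    by (simp add: bracket_add_left component_add bracket_closed component_carrier)
next
  case (homogeneous k u)
  have "u \<otimes>\<^bsub>L\<^esub> x \<in> \<Gamma> (k \<otimes>\<^bsub>G\<^esub> h)"
    using bracket_degree homogeneous h x by blast
  then have "component (g \<otimes>\<^bsub>G\<^esub> h) (u \<otimes>\<^bsub>L\<^esub> x)
      = (if g \<otimes>\<^bsub>G\<^esub> h = k \<otimes>\<^bsub>G\<^esub> h then u \<otimes>\<^bsub>L\<^esub> x else \<zero>\<^bsub>L\<^esub>)"
    using component_homogeneous[of "k \<otimes>\<^bsub>G\<^esub> h" "g \<otimes>\<^bsub>G\<^esub> h"] g h homogeneous(1) by blast
  also have "\<dots> = (if g = k then u \<otimes>\<^bsub>L\<^esub> x else \<zero>\<^bsub>L\<^esub>)"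
    using g h homogeneous(1) by (simp only: grp.right_cancel)
  also have "\<dots> = component g u \<otimes>\<^bsub>L\<^esub> x"
    unfolding component_homogeneous[OF homogeneous(1) g homogeneous(2)]
    using bracket_zero_left[OF part_carrier[OF h x]] by auto
  finally show ?case .
qed

lemma component_in_center:
  assumes z: "z \<in> lie_center L" and g: "g \<in> carrier G"
  shows "component g z \<in> lie_center L"
proof -
  have zc: "z \<in> carrier L"
    using z by (rule center_carrier)
  have c: "component g z \<in> carrier L"
    using zc g by (rule component_carrier)
  have "component g z \<otimes>\<^bsub>L\<^esub> x = \<zero>\<^bsub>L\<^esub>" if "x \<in> carrier L" for x
    using that
  proof (induction rule: homogeneous_induct)
    case zero
    then show ?case using c by (rule bracket_zero_right)
  next
    case (add u v)
    then show ?case using c by (simp add: bracket_add_right)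
  next
    case (homogeneous h u)
    have "component g z \<otimes>\<^bsub>L\<^esub> u = component (g \<otimes>\<^bsub>G\<^esub> h) (z \<otimes>\<^bsub>L\<^esub> u)"
      using component_bracket[OF g homogeneous(1) zc homogeneous(2)] by simp
    also have "\<dots> = \<zero>\<^bsub>L\<^esub>"
      using z part_carrier[OF homogeneous] g homogeneous(1)
      by (simp add: lie_center_def component_zero)
    finally show ?case .
  qed
  then show ?thesis
    using c by (simp add: lie_center_def)
qed

end

section \<open>Isomorphisms that are graded up to the center\<close>

text \<open>
  The hypotheses on the center and on the quotient by it, in terms of vectors instead of cosets.
\<close>

locale graded_mod_center_iso =
  A1: graded_lie_algebra F L1 G \<Gamma>1 + A2: graded_lie_algebra F L2 G \<Gamma>2
  for F :: "('k, 'm) ring_scheme" and G :: "('g, 'p) monoid_scheme"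
    and L1 :: "('k, 'a, 'n) module_scheme" and \<Gamma>1 :: "'g \<Rightarrow> 'a set"
    and L2 :: "('k, 'b, 'q) module_scheme" and \<Gamma>2 :: "'g \<Rightarrow> 'b set" +
  fixes \<psi> :: "'a \<Rightarrow> 'b"
  assumes iso: "\<psi> \<in> lie_iso F L1 L2"
    and graded_mod_center: "\<lbrakk>g \<in> carrier G; x \<in> \<Gamma>1 g\<rbrakk>
          \<Longrightarrow> \<exists>z\<in>lie_center L2. \<exists>y\<in>\<Gamma>2 g. \<psi> x = z \<oplus>\<^bsub>L2\<^esub> y"
    and graded_on_center: "\<lbrakk>g \<in> carrier G; x \<in> lie_center L1; x \<in> \<Gamma>1 g\<rbrakk> \<Longrightarrow> \<psi> x \<in> \<Gamma>2 g"

sublocale graded_mod_center_iso \<subseteq> decomposed_linear_map F L1 L2 "carrier G" \<Gamma>1 \<Gamma>2 \<psi>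
  by unfold_locales (use iso in \<open>auto simp: lie_iso_def bij_betw_def\<close>)

context graded_mod_center_iso
begin

lemma iso_bij: "bij_betw \<psi> (carrier L1) (carrier L2)"
  and iso_bracket: "\<lbrakk>x \<in> carrier L1; y \<in> carrier L1\<rbrakk> \<Longrightarrow> \<psi> (x \<otimes>\<^bsub>L1\<^esub> y) = \<psi> x \<otimes>\<^bsub>L2\<^esub> \<psi> y"
  using iso by (auto simp: lie_iso_def)

lemma iso_center_iff:
  assumes x: "x \<in> carrier L1"
  shows "\<psi> x \<in> lie_center L2 \<longleftrightarrow> x \<in> lie_center L1"
proof -
  have "\<psi> x \<in> lie_center L2 \<longleftrightarrow> (\<forall>y\<in>carrier L1. \<psi> x \<otimes>\<^bsub>L2\<^esub> \<psi> y = \<zero>\<^bsub>L2\<^esub>)"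
    using map_closed[OF x] bij_betw_imp_surj_on[OF iso_bij, symmetric] by (simp add: lie_center_def)
  also have "\<dots> \<longleftrightarrow> (\<forall>y\<in>carrier L1. \<psi> (x \<otimes>\<^bsub>L1\<^esub> y) = \<psi> \<zero>\<^bsub>L1\<^esub>)"
    using x by (simp add: iso_bracket map_zero)
  also have "\<dots> \<longleftrightarrow> (\<forall>y\<in>carrier L1. x \<otimes>\<^bsub>L1\<^esub> y = \<zero>\<^bsub>L1\<^esub>)"
    using bij_betw_imp_inj_on[OF iso_bij] x
    by (metis A1.bracket_closed A1.M.zero_closed inj_on_eq_iff)
  finally show ?thesis
    using x by (simp add: lie_center_def)
qed

text \<open>
  For \<open>x\<close> of degree \<open>g\<close> with \<open>\<psi> x = z + y\<close> as in the hypothesis, the difference is \<open>z\<close> minus its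
  component of degree \<open>g\<close>, which is central because \<open>\<zz>(L2)\<close> is graded.
\<close>

lemma degree_part_mod_center:
  assumes "x \<in> carrier L1"
  shows "\<exists>z\<in>lie_center L2. \<psi> x = degree_part x \<oplus>\<^bsub>L2\<^esub> z"
  using assms
proof (induction rule: A1.homogeneous_induct)
  case zero
  then show ?case
    using A2.center_zero by (auto simp: map_zero degree_part_zero intro!: bexI[of _ "\<zero>\<^bsub>L2\<^esub>"])
next
  case (add u v)
  then obtain z w where zw: "z \<in> lie_center L2" "w \<in> lie_center L2"
    "\<psi> u = degree_part u \<oplus>\<^bsub>L2\<^esub> z" "\<psi> v = degree_part v \<oplus>\<^bsub>L2\<^esub> w"
    by blast
  then have "\<psi> (u \<oplus>\<^bsub>L1\<^esub> v) = degree_part (u \<oplus>\<^bsub>L1\<^esub> v) \<oplus>\<^bsub>L2\<^esub> (z \<oplus>\<^bsub>L2\<^esub> w)"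
    using add.hyps degree_part_closed[of u] degree_part_closed[of v] A2.center_carrier
    by (simp add: map_add degree_part_add A2.M.a_ac)
  then show ?case
    using A2.center_add zw by blast
next
  case (homogeneous g u)
  obtain z y where zy: "z \<in> lie_center L2" "y \<in> \<Gamma>2 g" "\<psi> u = z \<oplus>\<^bsub>L2\<^esub> y"
    using graded_mod_center[OF homogeneous] by blast
  let ?c = "A2.component g z"
  have c: "?c \<in> lie_center L2"
    using A2.component_in_center homogeneous(1) zy(1) by blast
  have carr: "z \<in> carrier L2" "?c \<in> carrier L2" "y \<in> carrier L2"
    using A2.center_carrier c zy A2.part_carrier homogeneous(1) by auto
  have "degree_part u = ?c \<oplus>\<^bsub>L2\<^esub> y"
    using degree_part_homogeneous[OF homogeneous] carr homogeneous(1) zy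
    by (simp add: A2.component_add A2.component_homogeneous)
  then have "degree_part u \<oplus>\<^bsub>L2\<^esub> (z \<oplus>\<^bsub>L2\<^esub> \<ominus>\<^bsub>L2\<^esub> ?c) = (?c \<oplus>\<^bsub>L2\<^esub> \<ominus>\<^bsub>L2\<^esub> ?c) \<oplus>\<^bsub>L2\<^esub> (z \<oplus>\<^bsub>L2\<^esub> y)"
    using carr by (simp add: A2.M.a_ac)
  also have "\<dots> = \<psi> u"
    using carr zy(3) by (simp add: A2.M.r_neg)
  finally have "\<psi> u = degree_part u \<oplus>\<^bsub>L2\<^esub> (z \<oplus>\<^bsub>L2\<^esub> \<ominus>\<^bsub>L2\<^esub> ?c)" by simp
  then show ?case
    using A2.center_add A2.center_minus c zy(1) by blast
qed

lemma degree_part_center: "z \<in> lie_center L1 \<Longrightarrow> degree_part z = \<psi> z"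
  by (rule degree_part_eq)
    (auto intro: A1.center_carrier graded_on_center A1.component_in_center A1.component_part)

text \<open>Central summands do not affect brackets.\<close>

lemma bracket_degree_part:
  assumes x: "x \<in> carrier L1" and y: "y \<in> carrier L1"
  shows "degree_part x \<otimes>\<^bsub>L2\<^esub> degree_part y = \<psi> (x \<otimes>\<^bsub>L1\<^esub> y)"
proof -
  obtain z where z: "z \<in> lie_center L2" "\<psi> x = degree_part x \<oplus>\<^bsub>L2\<^esub> z"
    using degree_part_mod_center[OF x] by blast
  obtain w where w: "w \<in> lie_center L2" "\<psi> y = degree_part y \<oplus>\<^bsub>L2\<^esub> w"
    using degree_part_mod_center[OF y] by blast
  show ?thesis
    unfolding iso_bracket[OF x y] z(2) w(2)
    using A2.bracket_mod_center[OF degree_part_closed[OF x] degree_part_closed[OF y] z(1) w(1)]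
    by (rule sym)
qed

lemma degree_part_degree:
  assumes "g \<in> carrier G" "x \<in> \<Gamma>1 g"
  shows "degree_part x \<in> \<Gamma>2 g"
  unfolding degree_part_homogeneous[OF assms]
  by (rule A2.component_part[OF map_closed[OF A1.part_carrier[OF assms]] assms(1)])

text \<open>
  For homogeneous \<open>x\<close> and \<open>y\<close>, \<open>bracket_degree_part\<close> makes \<open>\<psi> [x, y]\<close> a bracket of two homogeneous
  vectors of the same degrees. So \<open>\<psi>\<close> preserves the degree of \<open>[x, y]\<close> and agrees with its
  degree-preserving part there.
\<close>

lemma degree_part_bracket:
  assumes x: "x \<in> carrier L1" and y: "y \<in> carrier L1"
  shows "degree_part (x \<otimes>\<^bsub>L1\<^esub> y) = degree_part x \<otimes>\<^bsub>L2\<^esub> degree_part y"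
proof -
  have "degree_part (x \<otimes>\<^bsub>L1\<^esub> y) = \<psi> (x \<otimes>\<^bsub>L1\<^esub> y)"
    using x
  proof (induction rule: A1.homogeneous_induct)
    case zero
    then show ?case
      using y by (simp add: A1.bracket_zero_left degree_part_zero map_zero)
  next
    case (add u v)
    then show ?case
      using y by (simp add: A1.bracket_add_left A1.bracket_closed degree_part_add map_add)
  next
    case (homogeneous g u)
    note u = A1.part_carrier[OF homogeneous]
    show ?case
      using y
    proof (induction rule: A1.homogeneous_induct)
      case zero
      then show ?case
        using u by (simp add: A1.bracket_zero_right degree_part_zero map_zero)
    next
      case (add v w)
      then show ?case
        using u by (simp add: A1.bracket_add_right A1.bracket_closed degree_part_add map_add)
    next
      case (homogeneous h v)
      note g = \<open>g \<in> carrier G\<close> and h = homogeneous(1)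
      have gh: "g \<otimes>\<^bsub>G\<^esub> h \<in> carrier G"
        using g h by simp
      have "u \<otimes>\<^bsub>L1\<^esub> v \<in> \<Gamma>1 (g \<otimes>\<^bsub>G\<^esub> h)"
        using A1.bracket_degree g h \<open>u \<in> \<Gamma>1 g\<close> homogeneous(2) by blast
      moreover have "\<psi> (u \<otimes>\<^bsub>L1\<^esub> v) \<in> \<Gamma>2 (g \<otimes>\<^bsub>G\<^esub> h)"
        using A2.bracket_degree[OF g h degree_part_degree[OF g \<open>u \<in> \<Gamma>1 g\<close>]
            degree_part_degree[OF homogeneous]]
        by (simp only: bracket_degree_part[OF u A1.part_carrier[OF homogeneous]])
      ultimately show ?case
        using degree_part_homogeneous[OF gh] A2.component_homogeneous[OF gh gh] by simp
    qed
  qed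
  then show ?thesis
    using bracket_degree_part[OF x y] by simp
qed

lemma degree_part_inj: "inj_on degree_part (carrier L1)"
proof -
  have ker: "x = \<zero>\<^bsub>L1\<^esub>" if x: "x \<in> carrier L1" and x0: "degree_part x = \<zero>\<^bsub>L2\<^esub>" for x
  proof -
    obtain z where "z \<in> lie_center L2" "\<psi> x = degree_part x \<oplus>\<^bsub>L2\<^esub> z"
      using degree_part_mod_center x by blast
    then have "\<psi> x \<in> lie_center L2"
      using x0 A2.center_carrier by simp
    then have "\<psi> x = \<psi> \<zero>\<^bsub>L1\<^esub>"
      using x x0 by (simp add: iso_center_iff degree_part_center map_zero)
    then show ?thesis
      using bij_betw_imp_inj_on[OF iso_bij] x by (simp add: inj_on_eq_iff)
  qed
  show ?thesis
  proof (rule inj_onI)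
    fix x y assume x: "x \<in> carrier L1" and y: "y \<in> carrier L1"
      and eq: "degree_part x = degree_part y"
    have "degree_part (x \<oplus>\<^bsub>L1\<^esub> \<ominus>\<^bsub>L1\<^esub> y) = degree_part (y \<oplus>\<^bsub>L1\<^esub> \<ominus>\<^bsub>L1\<^esub> y)"
      using x y eq by (simp add: degree_part_add)
    then have "x \<oplus>\<^bsub>L1\<^esub> \<ominus>\<^bsub>L1\<^esub> y = \<zero>\<^bsub>L1\<^esub>"
      using x y by (intro ker) (auto simp: A1.M.r_neg degree_part_zero)
    then show "x = y"
      using x y A1.M.minus_equality A1.M.minus_minus by fastforce
  qed
qed

lemma degree_part_surj: "degree_part ` carrier L1 = carrier L2"
proof
  show "degree_part ` carrier L1 \<subseteq> carrier L2"
    using degree_part_closed by blast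
  show "carrier L2 \<subseteq> degree_part ` carrier L1"
  proof
    fix y assume "y \<in> carrier L2"
    then obtain x where x: "x \<in> carrier L1" "y = \<psi> x"
      using iso_bij by (auto simp: bij_betw_def)
    obtain z where z: "z \<in> lie_center L2" "\<psi> x = degree_part x \<oplus>\<^bsub>L2\<^esub> z"
      using degree_part_mod_center x by blast
    obtain w where w: "w \<in> carrier L1" "z = \<psi> w"
      using A2.center_carrier[OF z(1)] iso_bij by (auto simp: bij_betw_def)
    then have "degree_part w = z"
      using z(1) iso_center_iff degree_part_center by simp
    then have "y = degree_part (x \<oplus>\<^bsub>L1\<^esub> w)"
      using x z w by (simp add: degree_part_add)
    then show "y \<in> degree_part ` carrier L1"
      using x w by blast
  qed
qed

lemma degree_part_graded_iso: "degree_part \<in> graded_lie_iso F G L1 \<Gamma>1 L2 \<Gamma>2"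
  using degree_part_inj degree_part_surj degree_part_add degree_part_smult degree_part_bracket
    degree_part_degree
  by (auto simp: graded_lie_iso_def lie_iso_def bij_betw_def)

end

text \<open>
  The image of the coset of \<open>x\<close> contains \<open>\<psi> x\<close> itself, so a homogeneous image of a homogeneous
  coset displays \<open>\<psi> x\<close> as a homogeneous vector plus a central one.
\<close>

lemma mod_center_if_induced_graded:
  assumes L1: "lie_algebra F L1" and L2: "lie_algebra F L2"
    and closed: "x \<in> carrier L1" "\<psi> x \<in> carrier L2"
    and x: "x \<in> \<Gamma> g"
    and graded: "induced_map L2 (lie_center L2) \<psi> ` quot_grading L1 (lie_center L1) \<Gamma> g
      \<subseteq> quot_grading L2 (lie_center L2) \<Delta> g"
  shows "\<exists>z\<in>lie_center L2. \<exists>y\<in>\<Delta> g. \<psi> x = z \<oplus>\<^bsub>L2\<^esub> y"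
proof -
  interpret L1: lie_algebra F L1 by (rule L1)
  interpret L2: lie_algebra F L2 by (rule L2)
  have "x \<in> lie_center L1 +>\<^bsub>L1\<^esub> x"
    using closed L1.center_zero by (auto simp: a_r_coset_def' intro!: bexI[of _ "\<zero>\<^bsub>L1\<^esub>"])
  moreover have "\<psi> x \<in> lie_center L2 +>\<^bsub>L2\<^esub> \<psi> x"
    using closed L2.center_zero by (auto simp: a_r_coset_def' intro!: bexI[of _ "\<zero>\<^bsub>L2\<^esub>"])
  ultimately have "\<psi> x \<in> induced_map L2 (lie_center L2) \<psi> (lie_center L1 +>\<^bsub>L1\<^esub> x)"
    by (auto simp: induced_map_def)
  moreover obtain y where "y \<in> \<Delta> g"
    "induced_map L2 (lie_center L2) \<psi> (lie_center L1 +>\<^bsub>L1\<^esub> x) = lie_center L2 +>\<^bsub>L2\<^esub> y"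
    using graded x by (auto simp: quot_grading_def)
  ultimately show ?thesis
    by (auto simp: a_r_coset_def')
qed

theorem theorem27:
  fixes F :: "('k, 'm) ring_scheme" and G :: "('g, 'p) monoid_scheme"
    and L1 :: "('k, 'a, 'n) module_scheme" and L2 :: "('k, 'b, 'q) module_scheme"
    and \<Gamma>1 :: "'g \<Rightarrow> 'a set" and \<Gamma>2 :: "'g \<Rightarrow> 'b set"
    and \<psi> :: "'a \<Rightarrow> 'b"
  assumes "field F" and "group G"
    and "graded_lie_algebra F L1 G \<Gamma>1" and "graded_lie_algebra F L2 G \<Gamma>2"
    and "\<psi> \<in> lie_iso F L1 L2"
    and "induced_map L2 (lie_center L2) \<psi> \<in> graded_lie_iso F G
           (quot_alg L1 (lie_center L1)) (quot_grading L1 (lie_center L1) \<Gamma>1)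
           (quot_alg L2 (lie_center L2)) (quot_grading L2 (lie_center L2) \<Gamma>2)"
    and "restrict \<psi> (lie_center L1) \<in> graded_lie_iso F G
           (center_alg L1) (center_grading L1 \<Gamma>1) (center_alg L2) (center_grading L2 \<Gamma>2)"
  shows "\<exists>\<phi>. \<phi> \<in> graded_lie_iso F G L1 \<Gamma>1 L2 \<Gamma>2"
proof -
  interpret A1: graded_lie_algebra F L1 G \<Gamma>1 by (rule assms(3))
  interpret A2: graded_lie_algebra F L2 G \<Gamma>2 by (rule assms(4))
  interpret graded_mod_center_iso F G L1 \<Gamma>1 L2 \<Gamma>2 \<psi>
  proof
    show "\<psi> \<in> lie_iso F L1 L2" by (rule assms(5))
  next
    fix g x assume g: "g \<in> carrier G" and x: "x \<in> \<Gamma>1 g"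
    have xc: "x \<in> carrier L1"
      using A1.part_carrier g x by blast
    moreover have "\<psi> x \<in> carrier L2"
      using assms(5) xc by (auto simp: lie_iso_def bij_betw_def)
    ultimately show "\<exists>z\<in>lie_center L2. \<exists>y\<in>\<Gamma>2 g. \<psi> x = z \<oplus>\<^bsub>L2\<^esub> y"
      by (rule mod_center_if_induced_graded[where \<Gamma> = \<Gamma>1,
            OF A1.lie_algebra_axioms A2.lie_algebra_axioms])
        (use assms(6) g x in \<open>auto simp: graded_lie_iso_def\<close>)
  next
    fix g x assume "g \<in> carrier G" "x \<in> lie_center L1" "x \<in> \<Gamma>1 g"
    then show "\<psi> x \<in> \<Gamma>2 g"
      using assms(7) by (auto simp: graded_lie_iso_def center_grading_def)
  qed
  show ?thesis
    using degree_part_graded_iso by blast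
qed

end
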